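(* Let $h$ be $\mathcal C^2$, $\kappa$-strongly convex for some $\kappa>0$, and of Legendre type on $\mathbb R^n$. Let $g_\gamma:\mathbb R^n\to\mathbb R\cup\{+\infty\}$ be the proper, differentiable potential and $\mathcal D_\gamma=I-\nabla g_\gamma$ the gradient step denoiser described in the context. Let $\psi_\gamma:\mathbb R^n\to\mathbb R\cup\{+\infty\}$ be a function with first-order derivatives $$\nabla\psi_\gamma(\mathbf y)=\begin{cases}\nabla^2h(\mathbf y)\cdot(\mathbf y-\nabla g_\gamma(\mathbf y)),&\mathbf y\in\mathrm{int\,dom}(h),\\+\infty,&\text{otherwise.}\end{cases}$$ Define $\phi_\gamma:\mathbb R^n\to\mathbb R\cup\{+\infty\}$ by $$\phi_\gamma(\mathbf x):=\begin{cases}\langle\mathbf x,\nabla h(\mathbf y)\rangle-h(\mathbf x)-\psi_\gamma(\mathbf y)\ \text{ for }\mathbf y\in\mathcal D_\gamma^{-1}(\mathbf x),&\mathbf x\in\mathrm{Im}(\mathcal D_\gamma),\\+\infty,&\text{otherwise,}\end{cases}$$ and $\mathcal B_\gamma:\mathrm{int\,dom}(h)\to\mathbb R^n$ by $\mathcal B_\gamma(\mathbf y):=\nabla(\psi_\gamma\circ\nabla h^* )(\nabla h(\mathbf y))$. Suppose that $\psi_\gamma\circ\nabla h^*$ is convex on $\mathrm{int\,dom}(h^* )$ and $\mathrm{Im}(\mathcal B_\gamma)\subset\mathrm{dom}(\phi_\gamma)=\mathrm{int\,dom}(h)$. Then for every $\mathbf y\in\mathrm{int\,dom}(h)$, $$\mathcal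 D_\gamma(\mathbf y)\in\mathrm{prox}^h_{\phi_\gamma}(\mathbf y).$$
   Context: $h^*$ is the convex conjugate of $h$. A proper lower semicontinuous convex $h$ is of Legendre type if it is essentially smooth (differentiable on $\mathrm{int\,dom}(h)$ with $\|\nabla h(\mathbf x^k)\|\to\infty$ along every sequence in $\mathrm{int\,dom}(h)$ converging to a boundary point of $\mathrm{dom}(h)$) and strictly convex on $\mathrm{int\,dom}(h)$; then $\nabla h:\mathrm{int\,dom}(h)\to\mathrm{int\,dom}(h^* )$ is a bijection with inverse $\nabla h^*$. $h$ is $\kappa$-strongly convex if $h-\frac\kappa2\|\cdot\|^2$ is convex. Bregman distance: $D_h(\mathbf x,\mathbf y)=h(\mathbf x)-h(\mathbf y)-\langle\nabla h(\mathbf y),\mathbf x-\mathbf y\rangle$ for $\mathbf x\in\mathrm{dom}(h)$, $\mathbf y\in\mathrm{int\,dom}(h)$. Bregman proximal operator: $\mathrm{prox}^h_f(\mathbf y)=\arg\min_{\mathbf x\in\mathbb R^n}\{f(\mathbf x)+D_h(\mathbf x,\mathbf y)\}$ (set of minimizers) for $\mathbf y\in\mathrm{int\,dom}(h)$. Gradient step (GS) denoiser: $\mathcal D_\gamma:=I-\nabla g_\gamma$ with $g_\gamma(\mathbf x)=\frac12\|\mathbf x-N_\gamma(\mathbf x)\|^2$, where $N_\gamma:\mathbb R^n\to\mathbb R^n$ is a (differentiable) deep neural network depending on a noise level $\gamma>0$, and $\nabla g_\gamma$ is $L_{g_\gamma}$-Lipschitz continuous with $L_{g_\gamma}<1$ (so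 $\mathcal D_\gamma$ is injective). *)

theory Defs
  imports "HOL-Analysis.Analysis"
begin

definition edom :: "('a \<Rightarrow> ereal) \<Rightarrow> 'a set" where
  "edom f = {x. f x < \<infinity>}"

definition proper_fun :: "('a \<Rightarrow> ereal) \<Rightarrow> bool" where
  "proper_fun f \<longleftrightarrow> (\<forall>x. f x \<noteq> -\<infinity>) \<and> (\<exists>x. f x \<noteq> \<infinity>)"

definition lsc_fun :: "('a::topological_space \<Rightarrow> ereal) \<Rightarrow> bool" where
  "lsc_fun f \<longleftrightarrow> (\<forall>x. f x \<le> Liminf (at x) f)"

definition convex_fun :: "('a::real_vector \<Rightarrow> ereal) \<Rightarrow> bool" where
  "convex_fun f \<longleftrightarrow> convex {(x, r :: real). f x \<le> ereal r}"

definition strongly_convex_fun :: "real \<Rightarrow> ('a::real_normed_vector \<Rightarrow> ereal) \<Rightarrow> bool" where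
  "strongly_convex_fun \<kappa> f \<longleftrightarrow> convex_fun (\<lambda>x. f x - ereal (\<kappa> / 2 * (norm x)\<^sup>2))"

definition strictly_convex_fun_on :: "'a::real_vector set \<Rightarrow> ('a \<Rightarrow> ereal) \<Rightarrow> bool" where
  "strictly_convex_fun_on S f \<longleftrightarrow>
     (\<forall>x\<in>S. \<forall>y\<in>S. \<forall>t. x \<noteq> y \<longrightarrow> 0 < t \<longrightarrow> t < 1 \<longrightarrow>
        f ((1 - t) *\<^sub>R x + t *\<^sub>R y) < ereal (1 - t) * f x + ereal t * f y)"

definition convex_conjugate :: "('a::real_inner \<Rightarrow> ereal) \<Rightarrow> 'a \<Rightarrow> ereal" where
  "convex_conjugate f z = (SUP x. ereal (z \<bullet> x) - f x)"

text \<open>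
  Differentiability at a point includes finiteness in a neighbourhood, since
  \<^const>\<open>real_of_ereal\<close> sends infinite values to \<open>0\<close>.
\<close>

definition has_gradient :: "('a::real_inner \<Rightarrow> ereal) \<Rightarrow> 'a \<Rightarrow> 'a \<Rightarrow> bool" where
  "has_gradient f y v \<longleftrightarrow>
     (\<forall>\<^sub>F x in nhds y. \<bar>f x\<bar> \<noteq> \<infinity>) \<and> (GDERIV (\<lambda>x. real_of_ereal (f x)) y :> v)"

definition gradient :: "('a::real_inner \<Rightarrow> ereal) \<Rightarrow> 'a \<Rightarrow> 'a" where
  "gradient f y = (THE v. has_gradient f y v)"

definition hessian :: "('a::real_inner \<Rightarrow> ereal) \<Rightarrow> 'a \<Rightarrow> 'a \<Rightarrow> 'a" where
  "hessian f y = frechet_derivative (gradient f) (at y)"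

text \<open>
  Used on open subsets of finite-dimensional spaces, where continuity of the Hessian
  applied to each fixed vector is continuity of the Hessian as a matrix.
\<close>

definition C2_on :: "'a::euclidean_space set \<Rightarrow> ('a \<Rightarrow> ereal) \<Rightarrow> bool" where
  "C2_on S f \<longleftrightarrow>
     (\<forall>y\<in>S. \<exists>v. has_gradient f y v) \<and>
     (\<forall>y\<in>S. gradient f differentiable (at y)) \<and>
     (\<forall>v. continuous_on S (\<lambda>y. hessian f y v))"

definition essentially_smooth :: "('a::real_inner \<Rightarrow> ereal) \<Rightarrow> bool" where
  "essentially_smooth h \<longleftrightarrow>
     (\<forall>y\<in>interior (edom h). \<exists>v. has_gradient h y v) \<and>
     (\<forall>X x. (\<forall>k::nat. X k \<in> interior (edom h)) \<longrightarrow> x \<in> frontier (edom h) \<longrightarrow> X \<longlonglongrightarrow> x \<longrightarrow>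
        filterlim (\<lambda>k. norm (gradient h (X k))) at_top sequentially)"

definition legendre_type :: "('a::real_inner \<Rightarrow> ereal) \<Rightarrow> bool" where
  "legendre_type h \<longleftrightarrow>
     proper_fun h \<and> lsc_fun h \<and> convex_fun h \<and>
     essentially_smooth h \<and> strictly_convex_fun_on (interior (edom h)) h"

text \<open>
  For \<open>y\<close> in the interior of the domain of a proper \<open>h\<close> this is \<open>+\<infinity>\<close> when \<open>x\<close> lies
  outside the domain, so it can be minimised over the whole space.
\<close>

definition bregman_dist :: "('a::real_inner \<Rightarrow> ereal) \<Rightarrow> 'a \<Rightarrow> 'a \<Rightarrow> ereal" where
  "bregman_dist h x y = h x - h y - ereal (gradient h y \<bullet> (x - y))"

definition bregman_prox :: "('a::real_inner \<Rightarrow> ereal) \<Rightarrow> ('a \<Rightarrow> ereal) \<Rightarrow> 'a \<Rightarrow> 'a set" where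
  "bregman_prox h f y = {x. is_arg_min (\<lambda>x. f x + bregman_dist h x y) (\<lambda>_. True) x}"

definition gs_potential :: "('a::real_inner \<Rightarrow> 'a) \<Rightarrow> 'a \<Rightarrow> ereal" where
  "gs_potential N x = ereal (1 / 2 * (norm (x - N x))\<^sup>2)"

definition gs_denoiser :: "('a::real_inner \<Rightarrow> ereal) \<Rightarrow> 'a \<Rightarrow> 'a" where
  "gs_denoiser g y = y - gradient g y"

text \<open>
  The formula for \<open>\<phi>\<close> involves the gradient of \<open>h\<close> at a preimage \<open>y\<close> of \<open>x\<close>, which exists
  only on the interior of the domain of \<open>h\<close>; image and preimage are therefore those of
  \<open>D\<close> as a map on that set. The preimage is unique when \<open>D\<close> is injective.
\<close>

definition gs_phi ::
  "('a::real_inner \<Rightarrow> ereal) \<Rightarrow> ('a \<Rightarrow> ereal) \<Rightarrow> ('a \<Rightarrow> 'a) \<Rightarrow> 'a \<Rightarrow> ereal" where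
  "gs_phi h \<psi> D x =
     (if x \<in> D ` interior (edom h)
      then (let y = inv_into (interior (edom h)) D x
            in ereal (x \<bullet> gradient h y) - h x - \<psi> y)
      else \<infinity>)"

definition gs_B :: "('a::real_inner \<Rightarrow> ereal) \<Rightarrow> ('a \<Rightarrow> ereal) \<Rightarrow> 'a \<Rightarrow> 'a" where
  "gs_B h \<psi> y = gradient (\<psi> \<circ> gradient (convex_conjugate h)) (gradient h y)"

end

theory Submission
  imports Defs
begin

text \<open>
  Strong convexity makes \<open>\<nabla>h\<close> expanding, hence injective with invertible derivative; by
  invariance of domain its image is open, and \<open>\<nabla>h*\<close> inverts it there. Since the Hessian \<open>H\<close>
  of \<open>h\<close> is symmetric, the chain rule cancels it and \<open>F = \<psi> \<circ> \<nabla>h*\<close> has gradient \<open>D z\<close> at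
  \<open>\<nabla>h z\<close>. The gradient inequality of the convex function \<open>F\<close> then reads
  \<open>\<psi> y \<ge> \<psi> z + \<langle>D z, \<nabla>h y - \<nabla>h z\<rangle>\<close>. With \<open>x = D z\<close> the terms \<open>h x\<close> cancel in
  \<open>\<phi> x + D\<^sub>h(x, y)\<close>, and this inequality says exactly that the objective is minimal at \<open>z = y\<close>.
  The assumption \<open>dom \<phi> = int dom h\<close> forces \<open>D\<close> to map \<open>int dom h\<close> onto itself, so the points
  \<open>D z\<close> exhaust the domain of \<open>\<phi>\<close>.
\<close>


section \<open>Uniqueness of gradients of extended-real functions\<close>

lemma has_gradientD:
  assumes "has_gradient f y v"
  shows "\<bar>f y\<bar> \<noteq> \<infinity>"
    and "((\<lambda>x. real_of_ereal (f x)) has_derivative (\<lambda>u. v \<bullet> u)) (at y)"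
  using assms unfolding has_gradient_def gderiv_def
  by (auto dest: eventually_nhds_x_imp_x simp: inner_commute)

lemma has_gradient_unique:
  assumes "has_gradient f y v" "has_gradient f y w"
  shows "v = w"
proof -
  have "(\<lambda>u. v \<bullet> u) = (\<lambda>u. w \<bullet> u)"
    using has_derivative_unique[OF has_gradientD(2)[OF assms(1)] has_gradientD(2)[OF assms(2)]] .
  then show ?thesis
    by (simp add: fun_eq_iff vector_eq_rdot)
qed

lemma gradient_eqI: "has_gradient f y v \<Longrightarrow> gradient f y = v"
  unfolding gradient_def using has_gradient_unique by blast

section \<open>First-order inequalities for convex and strongly convex functions\<close>

text \<open>Dividing the chord bound by \<open>t\<close> bounds the difference quotient by
  \<open>r - f y\<close>, and this passes to the limit. The bound is asked only for small
  \<open>t > 0\<close>, and \<open>r\<close> stands in for a value at \<open>y + u\<close>, so that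
  functions that are finite or convex only on part of the space are covered.\<close>

lemma derivative_le_of_eventually_chord:
  fixes f :: "'a::real_normed_vector \<Rightarrow> real"
  assumes der: "(f has_derivative f') (at y)"
    and le: "\<forall>\<^sub>F t in at_right 0. f (y + t *\<^sub>R u) \<le> (1 - t) * f y + t * r"
  shows "f' u \<le> r - f y"
proof -
  interpret bounded_linear f' using der by (rule has_derivative_bounded_linear)
  have "((\<lambda>t. f (y + t *\<^sub>R u)) has_derivative (\<lambda>t. f' (t *\<^sub>R u))) (at 0)"
    by (rule has_derivative_compose[of "\<lambda>t. y + t *\<^sub>R u" "\<lambda>t. t *\<^sub>R u" 0 UNIV f])
      (auto intro!: derivative_eq_intros der)
  then have "((\<lambda>t. f (y + t *\<^sub>R u)) has_real_derivative f' u) (at 0)"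
    unfolding has_field_derivative_def
    by (rule has_derivative_eq_rhs) (simp add: fun_eq_iff scaleR)
  then have "((\<lambda>t. (f (y + t *\<^sub>R u) - f y) / t) \<longlongrightarrow> f' u) (at_right 0)"
    by (auto simp: has_field_derivative_iff intro: filterlim_mono at_le)
  moreover have "\<forall>\<^sub>F t in at_right (0::real). (f (y + t *\<^sub>R u) - f y) / t \<le> r - f y"
    using le eventually_at_right_less[of 0]
    by eventually_elim (simp add: divide_simps algebra_simps)
  ultimately show ?thesis
    by (rule tendsto_upperbound) simp
qed

text \<open>For every real \<open>r\<close> above \<open>f x\<close>, the epigraph contains the
  segment from \<open>(y, f y)\<close> to \<open>(x, r)\<close>, which bounds \<open>f\<close> along
  the ray from \<open>y\<close> to \<open>x\<close>. Arguing with \<open>r\<close> instead of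
  \<open>f x\<close> also covers infinite values of \<open>f x\<close>.\<close>

lemma convex_fun_gradient_ineq:
  assumes f: "convex_fun f" and grad: "has_gradient f y v"
  shows "f y + ereal (v \<bullet> (x - y)) \<le> f x"
proof (rule ereal_le_real)
  fix r assume r: "f x \<le> ereal r"
  let ?f = "\<lambda>x. real_of_ereal (f x)"
  have fy: "f y = ereal (?f y)"
    using has_gradientD(1)[OF grad] by (simp add: ereal_real)
  have "((\<lambda>t. y + t *\<^sub>R (x - y)) \<longlongrightarrow> y + 0 *\<^sub>R (x - y)) (at_right (0::real))"
    by (intro tendsto_intros)
  \<comment> \<open>Finiteness near \<open>y\<close> rules out the value
    \<open>-\<infinity>\<close>, which \<open>real_of_ereal\<close> would turn into 0, losing the
    upper bound.\<close>
  then have fin: "\<forall>\<^sub>F t in at_right (0::real). \<bar>f (y + t *\<^sub>R (x - y))\<bar> \<noteq> \<infinity>"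
    using grad unfolding has_gradient_def by (auto simp: filterlim_iff)
  have "\<forall>\<^sub>F t in at_right 0. ?f (y + t *\<^sub>R (x - y)) \<le> (1 - t) * ?f y + t * r"
    using fin eventually_at_right_less[of 0] eventually_at_right_real[of 0 1, OF zero_less_one]
  proof eventually_elim
    case (elim t)
    have "(1 - t) *\<^sub>R (y, ?f y) + t *\<^sub>R (x, r) \<in> {(x, r). f x \<le> ereal r}"
      using f r fy elim unfolding convex_fun_def
      by (intro convexD) auto
    moreover have "(1 - t) *\<^sub>R y + t *\<^sub>R x = y + t *\<^sub>R (x - y)"
      by (simp add: algebra_simps)
    ultimately have "f (y + t *\<^sub>R (x - y)) \<le> ereal ((1 - t) * ?f y + t * r)"
      by simp
    with elim(1) show ?case
      by (cases "f (y + t *\<^sub>R (x - y))") auto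
  qed
  from derivative_le_of_eventually_chord[OF has_gradientD(2)[OF grad] this]
  have "?f y + v \<bullet> (x - y) \<le> r"
    by simp
  then show "f y + ereal (v \<bullet> (x - y)) \<le> ereal r"
    by (subst fy) simp
qed

text \<open>The convex function \<open>?k\<close>, which is \<open>f\<close> minus the quadratic
  \<open>?q\<close>, has gradient \<open>v - \<kappa> *\<^sub>R y\<close> at \<open>y\<close>. Its
  gradient inequality, after completing the square, is the claim.\<close>

lemma strongly_convex_fun_gradient_ineq:
  assumes f: "strongly_convex_fun \<kappa> f" and grad: "has_gradient f y v"
  shows "f y + ereal (v \<bullet> (x - y) + \<kappa> / 2 * (norm (x - y))\<^sup>2) \<le> f x"
proof -
  let ?q = "\<lambda>x. \<kappa> / 2 * (norm x)\<^sup>2"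
  let ?k = "\<lambda>x. f x - ereal (?q x)"
  have "has_gradient ?k y (v - \<kappa> *\<^sub>R y)"
    unfolding has_gradient_def gderiv_def
  proof
    show "\<forall>\<^sub>F x in nhds y. \<bar>?k x\<bar> \<noteq> \<infinity>"
      using grad unfolding has_gradient_def by (auto elim: eventually_mono)
    \<comment> \<open>\<open>real_of_ereal\<close> distributes over the difference where
      \<open>f\<close> is finite, hence the restriction to a neighbourhood \<open>S\<close>.\<close>
    obtain S where S: "open S" "y \<in> S" "\<And>x. x \<in> S \<Longrightarrow> \<bar>f x\<bar> \<noteq> \<infinity>"
      using conjunct1[OF grad[unfolded has_gradient_def eventually_nhds]] by metis
    have "((\<lambda>x. real_of_ereal (f x) - ?q x) has_derivative (\<lambda>u. u \<bullet> (v - \<kappa> *\<^sub>R y))) (at y)"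
      unfolding power2_norm_eq_inner
      by (rule has_derivative_eq_rhs[OF has_derivative_diff[OF has_gradientD(2)[OF grad]
              has_derivative_mult_right[OF has_derivative_inner[OF has_derivative_ident has_derivative_ident]]]])
        (simp add: fun_eq_iff inner_diff_right inner_commute)
    then show "((\<lambda>x. real_of_ereal (?k x)) has_derivative (\<lambda>u. u \<bullet> (v - \<kappa> *\<^sub>R y))) (at y)"
    proof (rule has_derivative_transform_within_open)
      fix x assume "x \<in> S"
      then show "real_of_ereal (f x) - ?q x = real_of_ereal (?k x)"
        using S(3)[of x] by (cases "f x") auto
    qed (fact S)+
  qed
  from convex_fun_gradient_ineq[OF f[unfolded strongly_convex_fun_def] this, of x]
  have "f y - ereal (?q y) + ereal ((v - \<kappa> *\<^sub>R y) \<bullet> (x - y)) \<le> f x - ereal (?q x)" .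
  moreover have "?q x - ?q y + (v - \<kappa> *\<^sub>R y) \<bullet> (x - y) = v \<bullet> (x - y) + ?q (x - y)"
    by (simp add: power2_norm_eq_inner algebra_simps inner_commute)
  moreover have "\<bar>f y\<bar> \<noteq> \<infinity>"
    using has_gradientD(1)[OF grad] .
  ultimately show ?thesis
    by (cases "f x"; cases "f y") auto
qed

text \<open>Adding the strong gradient inequalities at \<open>x\<close> and at \<open>y\<close>
  cancels the function values and leaves strong monotonicity of the gradient; Cauchy-Schwarz does
  the rest.\<close>

lemma strongly_convex_fun_gradient_expanding:
  assumes f: "strongly_convex_fun \<kappa> f"
    and x: "has_gradient f x v" and y: "has_gradient f y w"
  shows "\<kappa> * norm (x - y) \<le> norm (v - w)"
proof -
  have "\<bar>f x\<bar> \<noteq> \<infinity>" "\<bar>f y\<bar> \<noteq> \<infinity>"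
    using x y by (auto dest: has_gradientD(1))
  then have "v \<bullet> (y - x) + \<kappa> / 2 * (norm (y - x))\<^sup>2 + (w \<bullet> (x - y) + \<kappa> / 2 * (norm (x - y))\<^sup>2) \<le> 0"
    using strongly_convex_fun_gradient_ineq[OF f x, of y] strongly_convex_fun_gradient_ineq[OF f y, of x]
    by (cases "f x"; cases "f y") auto
  then have "\<kappa> * norm (x - y) * norm (x - y) \<le> (v - w) \<bullet> (x - y)"
    by (simp add: norm_minus_commute power2_eq_square algebra_simps)
  also have "\<dots> \<le> norm (v - w) * norm (x - y)"
    by (rule norm_cauchy_schwarz)
  finally show ?thesis
    by (cases "x = y") auto
qed

section \<open>Invertibility and symmetry of the Hessian\<close>

text \<open>Along a nonzero kernel vector of \<open>H\<close>, \<open>d\<close> would move by only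
  \<open>o(t)\<close>, against the linear lower bound with constant \<open>c\<close>.\<close>

lemma expanding_derivative_inj:
  fixes d :: "'a::real_normed_vector \<Rightarrow> 'b::real_normed_vector"
  assumes der: "(d has_derivative H) (at z)" and S: "open S" "z \<in> S"
    and c: "c > 0" and exp: "\<And>x. x \<in> S \<Longrightarrow> c * norm (x - z) \<le> norm (d x - d z)"
  shows "inj H"
proof -
  interpret bounded_linear H using der by (rule has_derivative_bounded_linear)
  have "u = 0" if "H u = 0" for u
  proof (rule ccontr)
    assume u: "u \<noteq> 0"
    obtain e where e: "e > 0" "ball z e \<subseteq> S"
      using S openE by blast
    obtain \<delta> where \<delta>: "\<delta> > 0"
      "\<And>y. norm (y - z) < \<delta> \<Longrightarrow> norm (d y - d z - H (y - z)) \<le> c / 2 * norm (y - z)"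
      using der c unfolding has_derivative_at_alt by (metis half_gt_zero)
    \<comment> \<open>This makes \<open>norm (t *\<^sub>R u)\<close> half of
      \<open>min \<delta> e\<close>, so \<open>z + t *\<^sub>R u\<close> is in \<open>S\<close> and
      within reach of the derivative estimate.\<close>
    define t where "t = min \<delta> e / (2 * norm u)"
    have t: "t > 0" "norm (t *\<^sub>R u) < \<delta>" "norm (t *\<^sub>R u) < e"
      using u e(1) \<delta>(1) by (auto simp: t_def)
    have "c * norm (t *\<^sub>R u) \<le> norm (d (z + t *\<^sub>R u) - d z)"
      using exp[of "z + t *\<^sub>R u"] e(2) t(3) by (auto simp: dist_norm subset_iff)
    also have "\<dots> \<le> c / 2 * norm (t *\<^sub>R u)"
      using \<delta>(2)[of "z + t *\<^sub>R u"] t(2) that by (simp add: scaleR)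
    finally show False
      using t(1) u c by simp
  qed
  then show ?thesis
    by (simp add: linear_injective_0 linear)
qed

text \<open>
  Its left-hand side is symmetric in \<open>u\<close> and \<open>v\<close>, which gives the symmetry of the Hessian from
  differentiability of the gradient at the single point \<open>z\<close>.
\<close>

lemma second_difference_gradient:
  fixes f :: "'a::real_inner \<Rightarrow> real"
  assumes S: "open S" "z \<in> S"
    and grad: "\<And>x. x \<in> S \<Longrightarrow> (f has_derivative (\<lambda>u. d x \<bullet> u)) (at x)"
    and der: "(d has_derivative H) (at z)"
  shows "((\<lambda>t. (f (z + t *\<^sub>R u + t *\<^sub>R v) - f (z + t *\<^sub>R u) - f (z + t *\<^sub>R v) + f z) / t\<^sup>2)
            \<longlongrightarrow> H u \<bullet> v) (at_right 0)"
proof -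
  interpret bounded_linear H using der by (rule has_derivative_bounded_linear)
  let ?\<Delta> = "\<lambda>t. f (z + t *\<^sub>R u + t *\<^sub>R v) - f (z + t *\<^sub>R u) - f (z + t *\<^sub>R v) + f z"
  define M where "M = norm u + norm v"
  obtain e where e: "e > 0" "ball z e \<subseteq> S"
    using S openE by blast
  have bound: "\<forall>\<^sub>F t in at_right 0. \<bar>?\<Delta> t / t\<^sup>2 - H u \<bullet> v\<bar> \<le> \<epsilon> * (2 * M * norm v)"
    if \<epsilon>: "\<epsilon> > 0" for \<epsilon>
  proof -
    obtain \<delta> where \<delta>: "\<delta> > 0"
      "\<And>y. norm (y - z) < \<delta> \<Longrightarrow> norm (d y - d z - H (y - z)) \<le> \<epsilon> * norm (y - z)"
      using der \<epsilon> unfolding has_derivative_at_alt by metis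
    have "((\<lambda>t. t * M) \<longlongrightarrow> 0 * M) (at_right 0)"
      by (intro tendsto_intros)
    then have "\<forall>\<^sub>F t in at_right 0. t * M < min \<delta> e"
      using \<delta>(1) e(1) by (intro order_tendstoD) auto
    then show ?thesis
      using eventually_at_right_less[of 0]
    proof eventually_elim
      case (elim t)
      have small: "norm (a *\<^sub>R u + b *\<^sub>R v) \<le> t * M" if "0 \<le> a" "a \<le> t" "0 \<le> b" "b \<le> t" for a b
        using that unfolding M_def
        by (intro order_trans[OF norm_triangle_ineq])
          (auto simp: distrib_left intro!: add_mono mult_right_mono)
      have inS: "z + (a *\<^sub>R u + b *\<^sub>R v) \<in> S" if "0 \<le> a" "a \<le> t" "0 \<le> b" "b \<le> t" for a b
      proof -
        have "z + (a *\<^sub>R u + b *\<^sub>R v) \<in> ball z e"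
          using small[OF that] elim(1) by (simp add: dist_commute[of z], simp add: dist_norm)
        then show ?thesis
          using e(2) by blast
      qed
      \<comment> \<open>Mean value theorem in the direction \<open>v\<close>, applied to the
        difference of \<open>f\<close> on the two sides of the parallelogram. The zero coefficients
        are kept so that both sides are instances of \<open>der\<close> below.\<close>
      have "\<exists>s\<in>{0<..<t}. (f (z + (t *\<^sub>R u + t *\<^sub>R v)) - f (z + (0 *\<^sub>R u + t *\<^sub>R v))) -
          (f (z + (t *\<^sub>R u + 0 *\<^sub>R v)) - f (z + (0 *\<^sub>R u + 0 *\<^sub>R v))) =
          (\<lambda>r. d (z + (t *\<^sub>R u + s *\<^sub>R v)) \<bullet> (r *\<^sub>R v) - d (z + (0 *\<^sub>R u + s *\<^sub>R v)) \<bullet> (r *\<^sub>R v)) (t - 0)"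
      proof (rule mvt_simple)
        fix s assume s: "0 \<le> s" "s \<le> t"
        have der: "((\<lambda>s. f (z + (a *\<^sub>R u + s *\<^sub>R v))) has_derivative
            (\<lambda>r. d (z + (a *\<^sub>R u + s *\<^sub>R v)) \<bullet> (r *\<^sub>R v))) (at s within {0..t})"
          if "a = 0 \<or> a = t" for a
          by (rule has_derivative_compose[of "\<lambda>s. z + (a *\<^sub>R u + s *\<^sub>R v)" "\<lambda>s. s *\<^sub>R v" s "{0..t}" f])
            (use that s elim(2) in \<open>auto intro!: derivative_eq_intros grad inS\<close>)
        show "((\<lambda>s. f (z + (t *\<^sub>R u + s *\<^sub>R v)) - f (z + (0 *\<^sub>R u + s *\<^sub>R v))) has_derivative
            (\<lambda>r. d (z + (t *\<^sub>R u + s *\<^sub>R v)) \<bullet> (r *\<^sub>R v) - d (z + (0 *\<^sub>R u + s *\<^sub>R v)) \<bullet> (r *\<^sub>R v))) (at s within {0..t})"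
          by (rule has_derivative_diff[OF der[OF disjI2[OF refl]] der[OF disjI1[OF refl]]])
      qed (use elim in auto)
      then obtain s where s: "0 < s" "s < t"
        and eq: "?\<Delta> t = t * ((d (z + (t *\<^sub>R u + s *\<^sub>R v)) - d (z + s *\<^sub>R v)) \<bullet> v)"
        by (auto simp: algebra_simps)
      define p q where "p = t *\<^sub>R u + s *\<^sub>R v" and "q = s *\<^sub>R v"
      have pq: "norm p \<le> t * M" "norm q \<le> t * M"
        using small[of t s] small[of 0 s] s by (auto simp: p_def q_def)
      \<comment> \<open>\<open>E\<close> collects the errors of the linearisation of
        \<open>d\<close> at \<open>z\<close> in the points \<open>z + p\<close> and
        \<open>z + q\<close>. The linear parts differ by exactly \<open>t *\<^sub>R H u\<close>,
        which yields the limit.\<close>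
      define E where "E = (d (z + p) - d z - H p) - (d (z + q) - d z - H q)"
      have "norm E \<le> \<epsilon> * norm p + \<epsilon> * norm q"
        unfolding E_def using \<delta>(2)[of "z + p"] \<delta>(2)[of "z + q"] pq elim(1)
        by (intro order_trans[OF norm_triangle_ineq4]) auto
      also have "\<dots> \<le> \<epsilon> * (2 * t * M)"
        using add_mono[OF mult_left_mono[OF pq(1)] mult_left_mono[OF pq(2)], of \<epsilon> \<epsilon>] \<epsilon> by (simp add: algebra_simps)
      finally have E: "norm E \<le> \<epsilon> * (2 * t * M)" .
      have "H p - H q = t *\<^sub>R H u"
        by (simp add: p_def q_def add scaleR)
      then have "d (z + p) - d (z + q) = t *\<^sub>R H u + E"
        by (simp add: E_def algebra_simps)
      then have "?\<Delta> t / t\<^sup>2 - H u \<bullet> v = (E \<bullet> v) / t"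
        using eq s by (simp add: p_def q_def inner_add_left power2_eq_square divide_simps algebra_simps)
      also have "\<bar>\<dots>\<bar> \<le> norm E * norm v / t"
        using elim(2) Cauchy_Schwarz_ineq2[of E v] by (simp add: divide_right_mono)
      also have "\<dots> \<le> \<epsilon> * (2 * t * M) * norm v / t"
        using E elim(2) by (intro divide_right_mono mult_right_mono) auto
      also have "\<dots> = \<epsilon> * (2 * M * norm v)"
        using elim(2) by simp
      finally show ?case .
    qed
  qed
  show ?thesis
  proof (rule tendstoI)
    fix e :: real assume e: "e > 0"
    have M: "2 * M * norm v \<ge> 0"
      by (simp add: M_def)
    \<comment> \<open>The summand 1 keeps the denominator positive even when
      \<open>M * norm v\<close> is 0.\<close>
    then have "e / (2 * M * norm v + 1) * (2 * M * norm v) < e"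
      using e by (simp add: divide_simps)
    with bound[of "e / (2 * M * norm v + 1)"] e M
    show "\<forall>\<^sub>F t in at_right 0. dist (?\<Delta> t / t\<^sup>2) (H u \<bullet> v) < e"
      by (auto simp: dist_real_def elim!: eventually_mono)
  qed
qed

lemma derivative_of_gradient_symmetric:
  fixes f :: "'a::real_inner \<Rightarrow> real"
  assumes "open S" "z \<in> S"
    and "\<And>x. x \<in> S \<Longrightarrow> (f has_derivative (\<lambda>u. d x \<bullet> u)) (at x)"
    and "(d has_derivative H) (at z)"
  shows "H u \<bullet> v = u \<bullet> H v"
proof -
  have "((\<lambda>t. (f (z + t *\<^sub>R u + t *\<^sub>R v) - f (z + t *\<^sub>R u) - f (z + t *\<^sub>R v) + f z) / t\<^sup>2)
            \<longlongrightarrow> H v \<bullet> u) (at_right 0)"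
    using second_difference_gradient[OF assms, of v u] by (simp add: algebra_simps)
  from tendsto_unique[OF _ second_difference_gradient[OF assms, of u v] this] show ?thesis
    by (simp add: inner_commute)
qed

section \<open>The convex conjugate and its gradient\<close>

text \<open>Equality case of the Fenchel-Young inequality: by the gradient inequality,
  \<open>y\<close> attains the supremum that defines the conjugate at \<open>w\<close>.\<close>

lemma convex_conjugate_gradient:
  assumes h: "convex_fun h" and y: "has_gradient h y w"
  shows "convex_conjugate h w = ereal (w \<bullet> y) - h y"
  unfolding convex_conjugate_def
proof (rule antisym)
  show "(SUP x. ereal (w \<bullet> x) - h x) \<le> ereal (w \<bullet> y) - h y"
  proof (rule SUP_least)
    fix x show "ereal (w \<bullet> x) - h x \<le> ereal (w \<bullet> y) - h y"
      using has_gradientD(1)[OF y] convex_fun_gradient_ineq[OF h y, of x]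
      by (cases "h x"; cases "h y") (auto simp: inner_diff_right)
  qed
qed (rule SUP_upper, simp)

text \<open>Since the image of \<open>U\<close> under \<open>d\<close> is open, each
  \<open>w\<close> near \<open>d y\<close> is \<open>d x\<close> for some \<open>x\<close> in
  \<open>U\<close>, and the remainder can be estimated through \<open>x\<close>. The bound of
  \<open>norm (x - y)\<close> by \<open>norm (d x - d y) / \<kappa>\<close> makes it at most
  quadratic in \<open>d x - d y\<close>.\<close>

lemma has_gradient_convex_conjugate:
  fixes h :: "'a::euclidean_space \<Rightarrow> ereal"
  assumes h: "convex_fun h" and \<kappa>: "\<kappa> > 0" and sc: "strongly_convex_fun \<kappa> h"
    and U: "open U" "y \<in> U" and grad: "\<And>x. x \<in> U \<Longrightarrow> has_gradient h x (d x)"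
    and cont: "continuous_on U d"
  shows "has_gradient (convex_conjugate h) (d y) y"
proof -
  let ?c = "convex_conjugate h"
  have exp: "\<kappa> * norm (x - x') \<le> norm (d x - d x')" if "x \<in> U" "x' \<in> U" for x x'
    using strongly_convex_fun_gradient_expanding[OF sc grad grad] that by blast
  have "inj_on d U"
  proof (rule inj_onI)
    fix x x' assume "x \<in> U" "x' \<in> U" "d x = d x'"
    then show "x = x'"
      using exp[of x x'] \<kappa> by (simp add: mult_le_0_iff)
  qed
  then have W: "open (d ` U)"
    by (rule invariance_of_domain[OF cont U(1)])
  have conj: "?c (d x) = ereal (d x \<bullet> x) - h x" if "x \<in> U" for x
    using convex_conjugate_gradient[OF h grad[OF that]] .
  have fin: "\<bar>?c (d x)\<bar> \<noteq> \<infinity>" if "x \<in> U" for x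
    using conj[OF that] has_gradientD(1)[OF grad[OF that]] by auto
  \<comment> \<open>\<open>x\<close> is a subgradient of the conjugate at \<open>d x\<close>; using this at both \<open>x\<close> and \<open>y\<close> traps the
    remainder in \<open>rem\<close>.\<close>
  have young: "?c (d x') - ?c (d x) - ereal ((d x' - d x) \<bullet> x) \<ge> 0" if "x \<in> U" "x' \<in> U" for x x'
    using convex_fun_gradient_ineq[OF h grad[OF that(2)], of x] conj that
      has_gradientD(1)[OF grad[OF that(1)]] has_gradientD(1)[OF grad[OF that(2)]]
    by (cases "h x"; cases "h x'") (auto simp: algebra_simps)
  have rem: "\<bar>real_of_ereal (?c (d x)) - real_of_ereal (?c (d y)) - (d x - d y) \<bullet> y\<bar>
      \<le> norm (d x - d y) * (norm (d x - d y) / \<kappa>)" if x: "x \<in> U" for x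
  proof -
    have 1: "0 \<le> real_of_ereal (?c (d x)) - real_of_ereal (?c (d y)) - (d x - d y) \<bullet> y"
      using young[OF U(2) x] fin[OF U(2)] fin[OF x]
      by (cases "?c (d x)"; cases "?c (d y)") auto
    have 2: "0 \<le> real_of_ereal (?c (d y)) - real_of_ereal (?c (d x)) - (d y - d x) \<bullet> x"
      using young[OF x U(2)] fin[OF U(2)] fin[OF x]
      by (cases "?c (d x)"; cases "?c (d y)") auto
    have "real_of_ereal (?c (d x)) - real_of_ereal (?c (d y)) - (d x - d y) \<bullet> y
        \<le> (d x - d y) \<bullet> (x - y)"
      using 2 by (simp add: inner_diff_left inner_diff_right)
    also have "\<dots> \<le> norm (d x - d y) * norm (x - y)"
      by (rule norm_cauchy_schwarz)
    also have "\<dots> \<le> norm (d x - d y) * (norm (d x - d y) / \<kappa>)"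
      using exp[OF x U(2)] \<kappa> by (intro mult_left_mono) (auto simp: field_simps)
    finally show ?thesis
      using 1 by simp
  qed
  have near: "\<forall>\<^sub>F w in nhds (d y). w \<in> d ` U"
    using W U(2) by (auto intro: eventually_nhds_in_open)
  show ?thesis
    unfolding has_gradient_def gderiv_def
  proof
    show "\<forall>\<^sub>F w in nhds (d y). \<bar>?c w\<bar> \<noteq> \<infinity>"
      using near
    proof (rule eventually_mono)
      fix w assume "w \<in> d ` U"
      then obtain x where x: "x \<in> U" "w = d x"
        by blast
      show "\<bar>?c w\<bar> \<noteq> \<infinity>"
        unfolding x(2) by (rule fin[OF x(1)])
    qed
    show "((\<lambda>w. real_of_ereal (?c w)) has_derivative (\<lambda>u. u \<bullet> y)) (at (d y))"
      unfolding has_derivative_within_alt2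
    proof (intro conjI allI impI bounded_linear_inner_left)
      fix e :: real assume e: "e > 0"
      \<comment> \<open>Within radius \<open>\<kappa> * e\<close>, the quadratic bound of
        \<open>rem\<close> is at most \<open>e\<close> times the distance.\<close>
      have "\<forall>\<^sub>F w in at (d y). dist w (d y) < \<kappa> * e"
        using \<kappa> e unfolding eventually_at by (intro exI[of _ "\<kappa> * e"]) simp
      moreover have "\<forall>\<^sub>F w in at (d y). w \<in> d ` U"
        using near by (simp add: eventually_at_filter eventually_mono)
      ultimately show "\<forall>\<^sub>F w in at (d y). norm (real_of_ereal (?c w) - real_of_ereal (?c (d y)) - (w - d y) \<bullet> y)
          \<le> e * norm (w - d y)"
      proof eventually_elim
        case (elim w)
        then obtain x where x: "x \<in> U" "w = d x"
          by blast
        have "norm (d x - d y) * (norm (d x - d y) / \<kappa>) \<le> norm (d x - d y) * e"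
          using elim(1) \<kappa> x(2) by (intro mult_left_mono) (auto simp: field_simps dist_norm)
        with rem[OF x(1)] show ?case
          unfolding x(2) by (simp add: mult.commute)
      qed
    qed
  qed
qed

lemma has_gradient_interior_edom:
  assumes "has_gradient f w y"
  shows "w \<in> interior (edom f)"
proof -
  obtain S where S: "open S" "w \<in> S" "\<And>x. x \<in> S \<Longrightarrow> \<bar>f x\<bar> \<noteq> \<infinity>"
    using conjunct1[OF assms[unfolded has_gradient_def eventually_nhds]] by metis
  have "S \<subseteq> edom f"
  proof
    fix x assume "x \<in> S"
    then show "x \<in> edom f"
      using S(3)[of x] by (cases "f x") (auto simp: edom_def)
  qed
  with S show ?thesis
    by (intro interiorI)
qed

section \<open>The subgradient inequality in mirror coordinates\<close>

text \<open>This is the gradient inequality of \<open>?F\<close> at \<open>?d z\<close>, evaluated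
  at \<open>?d y\<close>; \<open>p\<close> takes the role of \<open>D z\<close>.\<close>

lemma mirror_subgradient_ineq:
  fixes h \<psi> :: "'a::euclidean_space \<Rightarrow> ereal"
  assumes h: "convex_fun h" and \<kappa>: "\<kappa> > 0" and sc: "strongly_convex_fun \<kappa> h"
    and U: "open U" "z \<in> U" "y \<in> U" and C2: "C2_on U h"
    and \<psi>: "has_gradient \<psi> z (hessian h z p)"
    and conv: "convex_on (interior (edom (convex_conjugate h)))
           (\<lambda>w. real_of_ereal (\<psi> (gradient (convex_conjugate h) w)))"
  shows "p \<bullet> (gradient h y - gradient h z) \<le> real_of_ereal (\<psi> y) - real_of_ereal (\<psi> z)"
proof -
  let ?d = "gradient h" and ?G = "gradient (convex_conjugate h)" and ?H = "hessian h z"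
  let ?F = "\<lambda>w. real_of_ereal (\<psi> (?G w))"
  have grad: "has_gradient h x (?d x)" if "x \<in> U" for x
    using C2 that unfolding C2_on_def by (metis gradient_eqI)
  have cont: "continuous_on U ?d"
    using C2 unfolding C2_on_def
    by (intro continuous_at_imp_continuous_on ballI differentiable_imp_continuous_within) auto
  have der: "(?d has_derivative ?H) (at z)"
    using C2 U(2) unfolding C2_on_def hessian_def by (simp add: frechet_derivative_works)
  note conj = has_gradient_convex_conjugate[OF h \<kappa> sc U(1) _ grad cont]
  have G: "?G (?d x) = x" if "x \<in> U" for x
    using gradient_eqI[OF conj[OF that]] by simp
  \<comment> \<open>A point where the conjugate has a gradient is interior to its domain, so
    \<open>?d x\<close> lies in the set where \<open>?F\<close> is assumed convex.\<close>
  have int: "?d x \<in> interior (edom (convex_conjugate h))" if "x \<in> U" for x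
    using has_gradient_interior_edom[OF conj[OF that]] by simp
  have "inj ?H"
    by (rule expanding_derivative_inj[OF der U(1,2) \<kappa>
          strongly_convex_fun_gradient_expanding[OF sc grad grad[OF U(2)]]])
  then have "surj ?H"
    by (rule linear_inj_imp_surj[OF has_derivative_linear[OF der]])
  then have inv: "?H \<circ> inv ?H = id"
    by (simp add: surj_iff)
  have symm: "?H u \<bullet> v = u \<bullet> ?H v" for u v
    by (rule derivative_of_gradient_symmetric[OF U(1,2) has_gradientD(2)[OF grad] der])
  \<comment> \<open>Inverse function theorem for the continuous map \<open>?d\<close> with left
    inverse \<open>?G\<close> on \<open>U\<close>.\<close>
  have "(?G has_derivative inv ?H) (at (?d z))"
    by (rule has_derivative_inverse_strong[OF U(1,2) cont G der inv])
  moreover have "((\<lambda>x. real_of_ereal (\<psi> x)) has_derivative (\<lambda>u. ?H p \<bullet> u)) (at (?G (?d z)))"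
    using has_gradientD(2)[OF \<psi>] G[OF U(2)] by simp
  ultimately have "(?F has_derivative (\<lambda>u. ?H p \<bullet> inv ?H u)) (at (?d z))"
    by (rule has_derivative_compose)
  \<comment> \<open>Symmetry moves \<open>?H\<close> from \<open>p\<close> onto
    \<open>inv ?H u\<close>, where the two cancel.\<close>
  also have "(\<lambda>u. ?H p \<bullet> inv ?H u) = (\<lambda>u. p \<bullet> u)"
    using inv by (simp add: fun_eq_iff symm)
  finally have derF: "(?F has_derivative (\<lambda>u. p \<bullet> u)) (at (?d z))" .
  have "\<forall>\<^sub>F t in at_right 0. ?F (?d z + t *\<^sub>R (?d y - ?d z)) \<le> (1 - t) * ?F (?d z) + t * ?F (?d y)"
    using eventually_at_right_real[OF zero_less_one]
  proof eventually_elim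
    case (elim t)
    have "?F ((1 - t) *\<^sub>R ?d z + t *\<^sub>R ?d y) \<le> (1 - t) * ?F (?d z) + t * ?F (?d y)"
      using elim by (intro convex_onD[OF conv] int U) auto
    then show ?case
      by (simp add: algebra_simps)
  qed
  from derivative_le_of_eventually_chord[OF derF this] show ?thesis
    by (simp add: G U)
qed

section \<open>Injectivity of the denoiser and the proximal inclusion\<close>

text \<open>Equal values would make \<open>x - y\<close> a difference of gradients, which is shorter
  than \<open>x - y\<close> unless \<open>x = y\<close>. Injectivity makes the preimage picked by
  \<open>inv_into\<close> in \<open>gs_phi\<close> the intended one.\<close>

lemma inj_gs_denoiser:
  assumes lip: "L-lipschitz_on UNIV (gradient g)" and L: "L < 1"
  shows "inj (gs_denoiser g)"
proof (rule injI)
  fix x y assume "gs_denoiser g x = gs_denoiser g y"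
  then have "x - y = gradient g x - gradient g y"
    by (simp add: gs_denoiser_def algebra_simps)
  then have "norm (x - y) \<le> L * norm (x - y)"
    using lipschitz_onD[OF lip, of x y] by (simp add: dist_norm)
  then have "(1 - L) * norm (x - y) \<le> 0"
    by (simp add: algebra_simps)
  then show "x = y"
    using L by (simp add: mult_le_0_iff)
qed

theorem proposition16:
  fixes h \<psi> \<phi> g :: "real ^ 'n \<Rightarrow> ereal"
    and N :: "real \<Rightarrow> real ^ 'n \<Rightarrow> real ^ 'n"
    and D B :: "real ^ 'n \<Rightarrow> real ^ 'n"
    and \<kappa> \<gamma> L :: real
  assumes "legendre_type h"
    and "C2_on (interior (edom h)) h"
    and "\<kappa> > 0" and "strongly_convex_fun \<kappa> h"
    and "\<gamma> > 0" and "\<forall>x. N \<gamma> differentiable (at x)"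
    and g_def: "g = gs_potential (N \<gamma>)"
    and "L-lipschitz_on UNIV (gradient g)" and "L < 1"
    and D_def: "D = gs_denoiser g"
    and "\<forall>y. \<psi> y \<noteq> -\<infinity>"
    and "\<forall>y\<in>interior (edom h). has_gradient \<psi> y (hessian h y (y - gradient g y))"
    and "\<forall>y. y \<notin> interior (edom h) \<longrightarrow> (\<nexists>v. has_gradient \<psi> y v)"
    and phi_def: "\<phi> = gs_phi h \<psi> D"
    and B_def: "B = gs_B h \<psi>"
    and "convex_on (interior (edom (convex_conjugate h)))
           (\<lambda>z. real_of_ereal (\<psi> (gradient (convex_conjugate h) z)))"
    and "B ` interior (edom h) \<subseteq> edom \<phi>"
    and "edom \<phi> = interior (edom h)"
  shows "\<forall>y\<in>interior (edom h). D y \<in> bregman_prox h \<phi> y"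
proof
  let ?U = "interior (edom h)" and ?d = "gradient h"
  fix y assume y: "y \<in> ?U"
  have h: "convex_fun h" and proper: "\<And>x. h x \<noteq> -\<infinity>"
    using \<open>legendre_type h\<close> unfolding legendre_type_def proper_fun_def by auto
  have fin_h: "\<bar>h x\<bar> \<noteq> \<infinity>" if "x \<in> ?U" for x
    using that interior_subset[of "edom h"] proper[of x] by (auto simp: edom_def)
  have \<psi>: "has_gradient \<psi> x (hessian h x (D x))" if "x \<in> ?U" for x
    using assms(12) that by (simp add: D_def gs_denoiser_def)
  have fin_\<psi>: "\<bar>\<psi> x\<bar> \<noteq> \<infinity>" if "x \<in> ?U" for x
    using has_gradientD(1)[OF \<psi>[OF that]] .
  have "inj D"
    unfolding D_def using inj_gs_denoiser assms(8,9) by blast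
  then have \<phi>_D: "\<phi> (D x) = ereal (D x \<bullet> ?d x) - h (D x) - \<psi> x" if "x \<in> ?U" for x
    using that inv_into_f_f[OF inj_on_subset[OF \<open>inj D\<close> subset_UNIV], of x ?U]
    by (simp add: phi_def gs_phi_def)
  have "edom \<phi> = D ` ?U"
  proof
    show "edom \<phi> \<subseteq> D ` ?U"
      by (auto simp: edom_def phi_def gs_phi_def split: if_splits)
    show "D ` ?U \<subseteq> edom \<phi>"
    proof clarify
      fix x assume x: "x \<in> ?U"
      \<comment> \<open>So far \<open>h (D x)\<close> is only known not to be
        \<open>-\<infinity>\<close>. If it is \<open>\<infinity>\<close>, then
        \<open>\<phi> (D x)\<close> is \<open>-\<infinity>\<close>, which still counts as in the
        domain.\<close>
      show "D x \<in> edom \<phi>"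
        using fin_\<psi>[OF x] proper[of "D x"]
        by (cases "h (D x)"; cases "\<psi> x") (auto simp: edom_def \<phi>_D[OF x])
    qed
  qed
  with assms(18) have image: "D ` ?U = ?U"
    by simp
  have obj: "\<phi> (D z) + bregman_dist h (D z) y
      = ereal (D z \<bullet> (?d z - ?d y) - real_of_ereal (\<psi> z) - real_of_ereal (h y) + ?d y \<bullet> y)"
    if z: "z \<in> ?U" for z
  proof -
    \<comment> \<open>With \<open>image\<close>, \<open>h (D z)\<close> is now finite and can cancel
      between \<open>\<phi>\<close> and the Bregman distance.\<close>
    have "D z \<in> ?U"
      using z image by blast
    then have "\<bar>h (D z)\<bar> \<noteq> \<infinity>"
      by (rule fin_h)
    then show ?thesis
      using fin_h[OF y] fin_\<psi>[OF z]
      by (cases "h (D z)"; cases "h y"; cases "\<psi> z")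
        (auto simp: \<phi>_D[OF z] bregman_dist_def inner_diff_right inner_commute)
  qed
  have "\<phi> (D y) + bregman_dist h (D y) y \<le> \<phi> x + bregman_dist h x y" for x
  proof (cases "x \<in> ?U")
    case True
    then obtain z where z: "z \<in> ?U" "x = D z"
      using image by blast
    have "D z \<bullet> (?d y - ?d z) \<le> real_of_ereal (\<psi> y) - real_of_ereal (\<psi> z)"
      by (rule mirror_subgradient_ineq[OF h assms(3,4) open_interior z(1) y assms(2) \<psi>[OF z(1)] assms(16)])
    then show ?thesis
      unfolding z(2) obj[OF z(1)] obj[OF y] by (simp add: inner_diff_right)
  next
    case False
    then have "\<phi> x = \<infinity>"
      using assms(18) by (auto simp: edom_def)
    \<comment> \<open>In \<open>ereal\<close>, \<open>\<infinity>\<close> plus anything is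
      \<open>\<infinity>\<close>, whatever the Bregman distance is.\<close>
    then show ?thesis
      by simp
  qed
  then show "D y \<in> bregman_prox h \<phi> y"
    unfolding bregman_prox_def is_arg_min_def by (simp add: not_less)
qed

end
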